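(* Let $A \in \mathbb{R}^{n\times n}$ be a square non-singular matrix, $\eta \in \mathbb{R}$, $k \ge 1$, and let $p_1,\dots,p_k,q_1,\dots,q_k \in \mathbb{R}$. Put $S(z) = z^k - p_1 z^{k-1} - \dots - p_k$ and $G(z) = q_1 z^{k-1} + q_2 z^{k-2} + \dots + q_k$, and assume $S(1) = 0$ and $G(1) \ne 0$. Consider the HGDA dynamics $$\mathbf{x}_{t+k} = \sum_{i=1}^k p_i \mathbf{x}_{t+k-i} - \eta \sum_{i=1}^k q_i A\mathbf{y}_{t+k-i}, \qquad \mathbf{y}_{t+k} = \sum_{i=1}^k p_i \mathbf{y}_{t+k-i} + \eta \sum_{i=1}^k q_i A^T\mathbf{x}_{t+k-i} \qquad (t\ge 0),$$ with initial conditions $\mathbf{x}_0,\dots,\mathbf{x}_{k-1},\mathbf{y}_0,\dots,\mathbf{y}_{k-1} \in \mathbb{R}^n$. Let $x^n + a_1 x^{n-1} + \dots + a_n$ be the characteristic polynomial of the matrix $\eta^2 A A^T$. Then the dynamics converge to a Nash equilibrium of the bilinear game $f(\mathbf{x},\mathbf{y}) = \mathbf{x}^T A\mathbf{y}$ from every choice of initial conditions if and only if the polynomial $$(-S^2(z))^{n} + a_1 (-S^2(z))^{n-1} G^2(z) + \dots + a_n (G^2(z))^{n}$$ in $z$ is stable.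
   Context: HGDA (Historical Gradient Descent/Ascent) with time horizon $k$ is a gradient-based method for the unconstrained zero-sum game with objective $f(\mathbf{x},\mathbf{y})=\mathbf{x}^TA\mathbf{y}$. Here $S^2(z) = (S(z))^2$ and $G^2(z) = (G(z))^2$. A polynomial is stable if all of its complex roots $z$ satisfy $|z|<1$. A Nash equilibrium is a pair $(\mathbf{x}^*,\mathbf{y}^* )$ with $f(\mathbf{x}^*,\mathbf{y}) \le f(\mathbf{x}^*,\mathbf{y}^* ) \le f(\mathbf{x},\mathbf{y}^* )$ for all $\mathbf{x},\mathbf{y}\in\mathbb{R}^n$. Convergence means that $\mathbf{x}_t$ and $\mathbf{y}_t$ have limits as $t \to \infty$. *)

theory Defs
  imports "HOL-Analysis.Analysis" "HOL-Computational_Algebra.Polynomial"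
begin

text \<open>\<open>det (x I - M)\<close>, computed over the polynomial ring.\<close>
definition charpoly :: "real ^ 'n ^ 'n \<Rightarrow> real poly" where
  "charpoly M = det (\<chi> i j. (if i = j then [:0, 1:] else 0) - [:M $ i $ j:])"

definition stable_poly :: "real poly \<Rightarrow> bool" where
  "stable_poly P \<longleftrightarrow> (\<forall>z::complex. poly (map_poly complex_of_real P) z = 0 \<longrightarrow> norm z < 1)"

definition bilinear_game :: "real ^ 'n ^ 'n \<Rightarrow> real ^ 'n \<Rightarrow> real ^ 'n \<Rightarrow> real" where
  "bilinear_game A x y = x \<bullet> (A *v y)"

definition nash_equilibrium ::
    "(real ^ 'n \<Rightarrow> real ^ 'n \<Rightarrow> real) \<Rightarrow> real ^ 'n \<Rightarrow> real ^ 'n \<Rightarrow> bool" where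
  "nash_equilibrium f xs ys \<longleftrightarrow> (\<forall>x y. f xs y \<le> f xs ys \<and> f xs ys \<le> f x ys)"

text \<open>The coefficient sequences \<open>p\<close> and \<open>q\<close> are used at the indices \<open>1, \<dots>, k\<close> only.\<close>

definition hgda_S :: "nat \<Rightarrow> (nat \<Rightarrow> real) \<Rightarrow> real poly" where
  "hgda_S k p = monom 1 k - (\<Sum>i=1..k. monom (p i) (k - i))"

definition hgda_G :: "nat \<Rightarrow> (nat \<Rightarrow> real) \<Rightarrow> real poly" where
  "hgda_G k q = (\<Sum>i=1..k. monom (q i) (k - i))"

text \<open>The recurrence starts at index \<open>k\<close>, so the values \<open>x 0, \<dots>, x (k - 1)\<close> and
  \<open>y 0, \<dots>, y (k - 1)\<close> are unconstrained and determine the pair of sequences: quantifying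
  over all \<open>x\<close> and \<open>y\<close> with this property is quantifying over all initial conditions.\<close>
definition hgda_dynamics ::
    "real ^ 'n ^ 'n \<Rightarrow> real \<Rightarrow> nat \<Rightarrow> (nat \<Rightarrow> real) \<Rightarrow> (nat \<Rightarrow> real)
      \<Rightarrow> (nat \<Rightarrow> real ^ 'n) \<Rightarrow> (nat \<Rightarrow> real ^ 'n) \<Rightarrow> bool" where
  "hgda_dynamics A \<eta> k p q x y \<longleftrightarrow> (\<forall>t.
     x (t + k) = (\<Sum>i=1..k. p i *\<^sub>R x (t + k - i))
                  - \<eta> *\<^sub>R (\<Sum>i=1..k. q i *\<^sub>R (A *v y (t + k - i))) \<and>
     y (t + k) = (\<Sum>i=1..k. p i *\<^sub>R y (t + k - i))
                  + \<eta> *\<^sub>R (\<Sum>i=1..k. q i *\<^sub>R (transpose A *v x (t + k - i))))"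

end

theory Submission
  imports Defs "HOL-Computational_Algebra.Fundamental_Theorem_Algebra"
begin

text \<open>
  The only Nash equilibrium is \<open>(0, 0)\<close>. With \<open>E\<close> the shift of sequences and \<open>M = \<eta>\<^sup>2 A A\<^sup>T\<close>, both
  \<open>x\<close> and \<open>A y\<close> are annihilated by \<open>S(E)\<^sup>2 + G(E)\<^sup>2 M\<close>; multiplying by the adjugate of this matrix of
  polynomials, every coordinate is annihilated by its determinant, which is up to sign the
  polynomial in question, so stability gives convergence to \<open>0\<close>. Conversely, a root \<open>z\<close> of the
  polynomial yields a complex solution \<open>x\<^sub>t = z\<^sup>t v\<close>, \<open>y\<^sub>t = z\<^sup>t w\<close> with \<open>v \<noteq> 0\<close>, and the real
  solutions \<open>Re (z\<^sup>t v)\<close> and \<open>Im (z\<^sup>t v)\<close> can tend to \<open>0\<close> only if \<open>|z| < 1\<close>.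
\<close>

section \<open>Polynomials in the shift operator\<close>

definition shift_op :: "'a::comm_ring_1 poly \<Rightarrow> (nat \<Rightarrow> 'a) \<Rightarrow> nat \<Rightarrow> 'a" where
  "shift_op p x t = (\<Sum>i\<le>degree p. coeff p i * x (t + i))"

text \<open>Coefficients beyond the degree vanish. This allows polynomials of different degrees to
  be handled over one common range of summation.\<close>

lemma shift_op_bound:
  assumes "degree p \<le> n"
  shows "shift_op p x t = (\<Sum>i\<le>n. coeff p i * x (t + i))"
  unfolding shift_op_def
  by (rule sum.mono_neutral_left) (use assms in \<open>auto simp: coeff_eq_0\<close>)

lemma shift_op_0 [simp]: "shift_op 0 x t = 0"
  by (simp add: shift_op_def)

lemma shift_op_zero_seq [simp]: "shift_op p (\<lambda>_. 0) t = 0"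
  by (simp add: shift_op_def)

lemma shift_op_add: "shift_op (p + q) x t = shift_op p x t + shift_op q x t"
proof -
  let ?n = "max (degree p) (degree q)"
  show ?thesis
    by (simp add: shift_op_bound[of p ?n] shift_op_bound[of q ?n]
        shift_op_bound[of "p + q" ?n] degree_add_le sum.distrib distrib_right)
qed

lemma shift_op_smult: "shift_op (smult c p) x t = c * shift_op p x t"
  unfolding shift_op_bound[OF degree_smult_le, of c p x t]
  by (simp add: shift_op_def sum_distrib_left mult.assoc)

lemma shift_op_minus: "shift_op (- p) x t = - shift_op p x t"
  using shift_op_smult[of "-1" p x t] by simp

lemma shift_op_diff: "shift_op (p - q) x t = shift_op p x t - shift_op q x t"
  using shift_op_add[of p "- q" x t] by (simp add: shift_op_minus)

lemma shift_op_sum: "shift_op (sum f I) x t = (\<Sum>i\<in>I. shift_op (f i) x t)"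
  by (induction I rule: infinite_finite_induct) (auto simp: shift_op_add)

lemma shift_op_pCons: "shift_op (pCons c p) x t = c * x t + shift_op p x (Suc t)"
  by (simp add: shift_op_bound[of "pCons c p" "Suc (degree p)"] degree_pCons_le shift_op_def
      sum.atMost_Suc_shift del: sum.atMost_Suc)

lemma shift_op_monom: "shift_op (monom c n) x t = c * x (t + n)"
proof -
  have "shift_op (monom c n) x t = (\<Sum>i\<le>n. coeff (monom c n) i * x (t + i))"
    by (rule shift_op_bound) (rule degree_monom_le)
  also have "\<dots> = (\<Sum>i\<le>n. if i = n then c * x (t + n) else 0)"
    by (rule sum.cong) auto
  finally show ?thesis by simp
qed

text \<open>Sequences form a module over the polynomial ring, with the variable acting as the shift.
  Hence all these operators commute and elimination works as over a commutative ring. The induction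
  needs \<open>t\<close> arbitrary because the variable advances the time by one.\<close>

lemma shift_op_mult: "shift_op (p * q) x t = shift_op p (shift_op q x) t"
  by (induction p arbitrary: t) (simp_all add: shift_op_add shift_op_smult shift_op_pCons)

lemma shift_op_seq_add:
  "shift_op p (\<lambda>t. x t + y t) t = shift_op p x t + shift_op p y t"
  by (simp add: shift_op_def sum.distrib distrib_left)

lemma shift_op_seq_cmult: "shift_op p (\<lambda>t. c * x t) t = c * shift_op p x t"
  by (simp add: shift_op_def sum_distrib_left mult_ac)

lemma shift_op_seq_sum:
  "shift_op p (\<lambda>t. \<Sum>i\<in>I. x i t) t = (\<Sum>i\<in>I. shift_op p (x i) t)"
  by (induction I rule: infinite_finite_induct) (auto simp: shift_op_seq_add)

text \<open>Geometric sequences are eigenvectors of the shift, with eigenvalue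
  \<open>z\<close>.\<close>

lemma shift_op_geometric: "shift_op p (\<lambda>t. z ^ t * c) t = poly p z * z ^ t * c"
  by (simp add: shift_op_def poly_altdef sum_distrib_left sum_distrib_right power_add mult_ac)

lemma shift_op_of_real:
  "shift_op (map_poly of_real p) (\<lambda>t. of_real (x t) :: 'a::{real_algebra_1,comm_ring_1}) t
     = of_real (shift_op p x t)"
  by (simp add: shift_op_def degree_map_poly coeff_map_poly)

lemma shift_op_Re:
  "shift_op p (\<lambda>t. Re (x t)) t = Re (shift_op (map_poly of_real p) x t)"
  by (simp add: shift_op_def degree_map_poly coeff_map_poly)

section \<open>Stable recurrences\<close>

lemma first_order_recurrence_tendsto_0:
  fixes x w :: "nat \<Rightarrow> complex"
  assumes rec: "\<And>t. x (Suc t) = r * x t + w t" and r: "norm r < 1" and w: "w \<longlonglongrightarrow> 0"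
  shows "x \<longlonglongrightarrow> 0"
proof (rule LIMSEQ_I)
  fix e :: real assume e: "e > 0"
  \<comment> \<open>Solves \<open>norm r * (e / 2) + d = e / 2\<close>, so the part
    \<open>e / 2\<close> of the bound below reproduces itself at every step once the forcing term
    stays below \<open>d\<close>.\<close>
  define d where "d = e / 2 * (1 - norm r)"
  have d: "d > 0" using e r by (simp add: d_def)
  from LIMSEQ_D[OF w this] obtain N where N: "\<And>t. t \<ge> N \<Longrightarrow> norm (w t) < d" by auto
  have bound: "norm (x (N + m)) \<le> norm r ^ m * norm (x N) + e / 2" for m
  proof (induction m)
    case 0
    then show ?case using e by simp
  next
    case (Suc m)
    have "norm (x (N + Suc m)) \<le> norm r * norm (x (N + m)) + norm (w (N + m))"
      using rec[of "N + m"] norm_triangle_ineq[of "r * x (N + m)" "w (N + m)"]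
      by (simp add: norm_mult)
    also have "\<dots> \<le> norm r * (norm r ^ m * norm (x N) + e / 2) + d"
      using N[of "N + m"] by (intro add_mono mult_left_mono Suc) auto
    also have "\<dots> = norm r ^ Suc m * norm (x N) + e / 2"
      by (simp add: d_def field_simps)
    finally show ?case .
  qed
  have "(\<lambda>m. norm r ^ m * norm (x N)) \<longlonglongrightarrow> 0 * norm (x N)"
    by (intro tendsto_intros LIMSEQ_realpow_zero) (use r in auto)
  then have "(\<lambda>m. norm r ^ m * norm (x N)) \<longlonglongrightarrow> 0" by simp
  from LIMSEQ_D[OF this half_gt_zero[OF e]]
  obtain K where K: "\<And>m. m \<ge> K \<Longrightarrow> norm r ^ m * norm (x N) < e / 2"
    by (auto simp: abs_mult)
  show "\<exists>no. \<forall>n\<ge>no. norm (x n - 0) < e"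
  proof (intro exI allI impI)
    fix n assume "n \<ge> N + K"
    then obtain m where m: "n = N + m" "m \<ge> K" by (metis add_leD1 le_iff_add nat_add_left_cancel_le)
    with bound[of m] K[of m] show "norm (x n - 0) < e" by simp
  qed
qed

text \<open>Induction on the degree by splitting off a root \<open>r\<close>: the sequence
  \<open>x (t + 1) - r * x t\<close> obeys the recurrence of the remaining factor, so it tends to 0,
  and it is the forcing term of a contracting first-order recurrence for \<open>x\<close>.\<close>

lemma complex_recurrence_tendsto_0:
  fixes p :: "complex poly"
  assumes "p \<noteq> 0" and "\<And>z. poly p z = 0 \<Longrightarrow> norm z < 1" and "shift_op p x \<longlonglongrightarrow> 0"
  shows "x \<longlonglongrightarrow> 0"
  using assms
proof (induction "degree p" arbitrary: p x)
  case 0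
  then obtain c where c: "p = [:c:]" "c \<noteq> 0" by (metis degree_eq_zeroE pCons_eq_0_iff)
  have "(\<lambda>t. shift_op p x t / c) \<longlonglongrightarrow> 0 / c"
    by (intro tendsto_intros 0) (use c in auto)
  moreover have "(\<lambda>t. shift_op p x t / c) = x"
    using c by (simp add: shift_op_pCons fun_eq_iff)
  ultimately show ?case by simp
next
  case (Suc n)
  have "\<not> constant (poly p)" using Suc.hyps(2) constant_degree[of p] by simp
  then obtain r where r: "poly p r = 0" using fundamental_theorem_of_algebra by blast
  then obtain q where q: "p = [:- r, 1:] * q" by (auto simp: poly_eq_0_iff_dvd)
  have "q \<noteq> 0" using q Suc.prems(1) by auto
  then have "degree p = Suc (degree q)"
    unfolding q by (subst degree_mult_eq) auto
  then have deg: "n = degree q" using Suc.hyps(2) by simp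
  let ?y = "shift_op [:- r, 1:] x"
  have "shift_op q ?y = shift_op p x"
    using q by (simp add: fun_eq_iff mult.commute flip: shift_op_mult)
  then have "shift_op q ?y \<longlonglongrightarrow> 0" using Suc.prems(3) by simp
  moreover have "norm z < 1" if "poly q z = 0" for z
    using Suc.prems(2)[of z] that by (simp add: q)
  ultimately have "?y \<longlonglongrightarrow> 0"
    using Suc.hyps(1)[OF deg \<open>q \<noteq> 0\<close>] by blast
  moreover have "x (Suc t) = r * x t + ?y t" for t by (simp add: shift_op_pCons)
  ultimately show ?case
    using Suc.prems(2)[OF r] first_order_recurrence_tendsto_0[of x r ?y] by blast
qed

lemma stable_poly_recurrence_tendsto_0:
  assumes stable: "stable_poly p" and rec: "\<And>t. shift_op p x t = 0"
  shows "x \<longlonglongrightarrow> 0"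
proof -
  let ?p = "map_poly complex_of_real p" and ?x = "\<lambda>t. complex_of_real (x t)"
  \<comment> \<open>Stability excludes the zero polynomial, which has the root 1.\<close>
  have "?p \<noteq> 0"
  proof
    assume "?p = 0"
    then have "poly ?p 1 = 0" by simp
    with stable have "norm (1::complex) < 1" unfolding stable_poly_def by blast
    then show False by simp
  qed
  moreover have "shift_op ?p ?x = (\<lambda>_. 0)" by (simp add: fun_eq_iff shift_op_of_real rec)
  ultimately have "?x \<longlonglongrightarrow> 0"
    using complex_recurrence_tendsto_0[of ?p ?x] stable unfolding stable_poly_def
    by (metis tendsto_const)
  from tendsto_Re[OF this] show ?thesis by simp
qed

section \<open>Determinants of polynomial matrices\<close>

text \<open>The transposed adjugate. Replacing a row by a unit vector gives the cofactor without
  passing to a minor over a smaller index type.\<close>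

definition cofactor_mat :: "'a::comm_ring_1 ^ 'n ^ 'n \<Rightarrow> 'a ^ 'n ^ 'n" where
  "cofactor_mat B = (\<chi> l i. det (\<chi> r. if r = l then axis i 1 else B $ r))"

text \<open>By linearity in row \<open>l\<close>, the sum is the determinant of \<open>B\<close>
  with row \<open>l\<close> replaced by row \<open>j\<close>; for distinct indices two rows
  coincide.\<close>

lemma cofactor_mat_expand:
  fixes B :: "'a::comm_ring_1 ^ 'n ^ 'n"
  shows "(\<Sum>i\<in>UNIV. cofactor_mat B $ l $ i * B $ j $ i) = (if l = j then det B else 0)"
proof -
  have "(\<Sum>i\<in>UNIV. cofactor_mat B $ l $ i * B $ j $ i)
      = (\<Sum>i\<in>UNIV. det (\<chi> r. if r = l then (B $ j $ i) *s axis i 1 else B $ r))"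
    by (simp add: cofactor_mat_def det_row_mul mult.commute)
  also have "\<dots> = det (\<chi> r. if r = l then (\<Sum>i\<in>UNIV. (B $ j $ i) *s axis i 1) else B $ r)"
    by (rule det_linear_row_sum[symmetric]) simp
  also have "(\<Sum>i\<in>UNIV. (B $ j $ i) *s axis i 1) = B $ j"
    by (rule basis_expansion)
  also have "det (\<chi> r. if r = l then B $ j else B $ r) = (if l = j then det B else 0)"
  proof (cases "l = j")
    case True
    then have "(\<chi> r. if r = l then B $ j else B $ r) = B" by (simp add: vec_eq_iff)
    with True show ?thesis by simp
  next
    case False
    then show ?thesis
      by (simp, intro det_identical_rows[of l j]) (auto simp: row_def)
  qed
  finally show ?thesis .
qed

text \<open>Cramer's rule without division: applying the adjugate to the system decouples it into
  one scalar recurrence per coordinate.\<close>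

lemma shift_op_det_eq_0:
  fixes B :: "'a::comm_ring_1 poly ^ 'n ^ 'n" and x :: "'n \<Rightarrow> nat \<Rightarrow> 'a"
  assumes sys: "\<And>i t. (\<Sum>j\<in>UNIV. shift_op (B $ i $ j) (x j) t) = 0"
  shows "shift_op (det B) (x l) t = 0"
proof -
  \<comment> \<open>The expansion above runs along rows, while eliminating unknowns needs it along
    columns of \<open>B\<close>; hence the transpose.\<close>
  let ?C = "cofactor_mat (transpose B)"
  have "0 = (\<Sum>i\<in>UNIV. shift_op (?C $ l $ i) (\<lambda>t. \<Sum>j\<in>UNIV. shift_op (B $ i $ j) (x j) t) t)"
    by (simp add: sys)
  also have "\<dots> = (\<Sum>i\<in>UNIV. \<Sum>j\<in>UNIV. shift_op (?C $ l $ i * B $ i $ j) (x j) t)"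
    by (simp add: shift_op_seq_sum shift_op_mult)
  also have "\<dots> = (\<Sum>j\<in>UNIV. shift_op (\<Sum>i\<in>UNIV. ?C $ l $ i * transpose B $ j $ i) (x j) t)"
    by (subst sum.swap) (simp add: shift_op_sum transpose_def)
  also have "\<dots> = (\<Sum>j\<in>UNIV. if l = j then shift_op (det B) (x j) t else 0)"
    by (rule sum.cong) (simp_all add: cofactor_mat_expand det_transpose)
  finally show ?thesis by simp
qed

lemma det_ring_hom:
  fixes h :: "'a::comm_ring_1 \<Rightarrow> 'b::comm_ring_1" and B :: "'a ^ 'n ^ 'n"
  assumes add: "\<And>a b. h (a + b) = h a + h b" and mult: "\<And>a b. h (a * b) = h a * h b"
    and one: "h 1 = 1"
  shows "h (det B) = det (\<chi> i j. h (B $ i $ j))"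
proof -
  have zero: "h 0 = 0" using add[of 0 0] by simp
  have minus: "h (- a) = - h a" for a
    using add[of a "- a"] zero by (simp add: minus_unique)
  have sum: "h (sum f I) = (\<Sum>i\<in>I. h (f i))" for f :: "('n \<Rightarrow> 'n) \<Rightarrow> 'a" and I
    by (induction I rule: infinite_finite_induct) (auto simp: zero add)
  have prod: "h (prod f I) = (\<Prod>i\<in>I. h (f i))" for f :: "'n \<Rightarrow> 'a" and I
    by (induction I rule: infinite_finite_induct) (auto simp: one mult)
  have "h (of_int (sign p)) = of_int (sign p)" for p :: "'n \<Rightarrow> 'n"
    by (simp add: sign_def one minus)
  then show ?thesis by (simp add: det_def sum mult prod)
qed

section \<open>Evaluation of real polynomials, and the homogenized characteristic polynomial\<close>

definition real_poly_eval :: "real poly \<Rightarrow> 'a::real_field \<Rightarrow> 'a" where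
  "real_poly_eval p z = poly (map_poly of_real p) z"

lemma real_poly_eval_pCons [simp]:
  "real_poly_eval (pCons c p) z = of_real c + z * real_poly_eval p z"
  by (simp add: real_poly_eval_def map_poly_pCons)

lemma real_poly_eval_0 [simp]: "real_poly_eval 0 z = 0"
  by (simp add: real_poly_eval_def)

lemma real_poly_eval_1 [simp]: "real_poly_eval 1 z = 1"
  by (simp add: one_pCons)

lemma real_poly_eval_add [simp]:
  "real_poly_eval (p + q) z = real_poly_eval p z + real_poly_eval q z"
  by (induction p q rule: poly_induct2) (auto simp: algebra_simps)

lemma real_poly_eval_smult [simp]:
  "real_poly_eval (smult c p) z = of_real c * real_poly_eval p z"
  by (induction p) (auto simp: algebra_simps)

lemma real_poly_eval_minus [simp]: "real_poly_eval (- p) z = - real_poly_eval p z"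
  using real_poly_eval_smult[of "-1" p z] by simp

lemma real_poly_eval_diff [simp]:
  "real_poly_eval (p - q) z = real_poly_eval p z - real_poly_eval q z"
  using real_poly_eval_add[of p "- q" z] by simp

lemma real_poly_eval_mult [simp]:
  "real_poly_eval (p * q) z = real_poly_eval p z * real_poly_eval q z"
  by (induction p) (auto simp: algebra_simps)

lemma real_poly_eval_power [simp]: "real_poly_eval (p ^ n) z = real_poly_eval p z ^ n"
  by (induction n) auto

lemma real_poly_eval_sum [simp]:
  "real_poly_eval (sum f I) z = (\<Sum>i\<in>I. real_poly_eval (f i) z)"
  by (induction I rule: infinite_finite_induct) auto

lemma real_poly_eval_monom [simp]: "real_poly_eval (monom c n) z = of_real c * z ^ n"
  by (induction n) (auto simp: monom_0 monom_Suc)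

lemma real_poly_eval_real: "real_poly_eval p (r :: real) = poly p r"
  by (induction p) auto

lemma real_poly_eval_det:
  fixes B :: "real poly ^ 'n ^ 'n"
  shows "real_poly_eval (det B) z = det (\<chi> i j. real_poly_eval (B $ i $ j) z)"
  by (rule det_ring_hom) auto

text \<open>For \<open>g \<noteq> 0\<close>, taking \<open>g\<close> out of every row leaves the
  characteristic polynomial at \<open>s / g\<close>. For \<open>g = 0\<close> the matrix is
  diagonal, and the sum vanishes because its powers of \<open>g\<close> start at 1. The field stays
  general to serve real points in the next lemma and complex roots in the theorem.\<close>

lemma det_homogeneous_charpoly:
  fixes M :: "real ^ 'n ^ 'n" and s g :: "'a::real_field"
  assumes chi: "charpoly M = monom 1 CARD('n) + (\<Sum>i=1..CARD('n). monom (a i) (CARD('n) - i))"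
  shows "det (\<chi> i j. (if i = j then s else 0) - g * of_real (M $ i $ j))
    = s ^ CARD('n) + (\<Sum>i=1..CARD('n). of_real (a i) * (s ^ (CARD('n) - i) * g ^ i))"
proof (cases "g = 0")
  case True
  have "(\<Sum>i=1..CARD('n). of_real (a i) * (s ^ (CARD('n) - i) * g ^ i)) = 0"
    by (rule sum.neutral) (simp add: True)
  moreover have "det (\<chi> i j. if i = j then s else 0 :: 'a ^ 'n ^ 'n) = s ^ CARD('n)"
    by (subst det_diagonal) auto
  ultimately show ?thesis by (simp add: True)
next
  case False
  let ?B = "\<chi> i j. (if i = j then s / g else 0) - of_real (M $ i $ j) :: 'a ^ 'n ^ 'n"
  have "det ?B = real_poly_eval (charpoly M) (s / g)"
    unfolding charpoly_def real_poly_eval_det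
    by (rule arg_cong[of _ _ det]) (simp add: vec_eq_iff)
  then have B: "det ?B = (s / g) ^ CARD('n)
      + (\<Sum>i=1..CARD('n). of_real (a i) * (s / g) ^ (CARD('n) - i))"
    by (simp add: chi)
  have "(\<chi> i j. (if i = j then s else 0) - g * of_real (M $ i $ j)) = (\<chi> i. g *s ?B $ i)"
    using False by (simp add: vec_eq_iff right_diff_distrib)
  then have "det (\<chi> i j. (if i = j then s else 0) - g * of_real (M $ i $ j))
      = g ^ CARD('n) * det ?B"
    by (simp only: det_rows_mul) (simp add: vec_lambda_eta)
  also have "\<dots> = s ^ CARD('n) + (\<Sum>i=1..CARD('n).
      of_real (a i) * (g ^ CARD('n) * (s / g) ^ (CARD('n) - i)))"
    using False by (simp add: B distrib_left sum_distrib_left power_divide mult_ac)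
  also have "(\<Sum>i=1..CARD('n). of_real (a i) * (g ^ CARD('n) * (s / g) ^ (CARD('n) - i)))
      = (\<Sum>i=1..CARD('n). of_real (a i) * (s ^ (CARD('n) - i) * g ^ i))"
  proof (rule sum.cong)
    fix i assume "i \<in> {1..CARD('n)}"
    then have "g ^ CARD('n) = g ^ (CARD('n) - i) * g ^ i"
      by (simp flip: power_add)
    then show "of_real (a i) * (g ^ CARD('n) * (s / g) ^ (CARD('n) - i))
        = of_real (a i) * (s ^ (CARD('n) - i) * g ^ i)"
      using False by (simp add: power_divide)
  qed simp
  finally show ?thesis .
qed

text \<open>Dividing by \<open>g\<close> is not possible among polynomials, so the identity is
  checked at every real point, which determines a real polynomial.\<close>

lemma det_homogeneous_charpoly_poly:
  fixes M :: "real ^ 'n ^ 'n" and s g :: "real poly"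
  assumes "charpoly M = monom 1 CARD('n) + (\<Sum>i=1..CARD('n). monom (a i) (CARD('n) - i))"
  shows "det (\<chi> i j. (if i = j then s else 0) - smult (M $ i $ j) g)
    = s ^ CARD('n) + (\<Sum>i=1..CARD('n). smult (a i) (s ^ (CARD('n) - i) * g ^ i))"
    (is "?l = ?r")
proof -
  have "poly ?l r = poly ?r r" for r
  proof -
    have "poly ?l r = det (\<chi> i j. real_poly_eval
        ((if i = j then s else 0) - smult (M $ i $ j) g) r)"
      by (simp add: real_poly_eval_det flip: real_poly_eval_real)
    also have "\<dots> = det (\<chi> i j. (if i = j then poly s r else 0) - poly g r * of_real (M $ i $ j))"
      by (rule arg_cong[of _ _ det]) (simp add: vec_eq_iff real_poly_eval_real)
    also have "\<dots> = poly ?r r"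
      using det_homogeneous_charpoly[OF assms, of "poly s r" "poly g r"] by (simp add: poly_sum)
    finally show ?thesis .
  qed
  then show ?thesis by (simp add: fun_eq_iff flip: poly_eq_poly_eq_iff)
qed

lemma singular_matrix_null_vector:
  fixes B :: "'a::field ^ 'n ^ 'n"
  assumes "det B = 0"
  obtains v where "v \<noteq> 0" "B *v v = 0"
  using assms matrix_left_invertible_ker[of B] invertible_left_inverse[of B]
    invertible_det_nz[of B] by blast

section \<open>The dynamics\<close>

text \<open>Two deviations suffice: moving \<open>ys\<close> by \<open>A' *v xs\<close> raises the
  payoff by \<open>xs \<bullet> xs\<close>, and moving \<open>xs\<close> by
  \<open>- (A *v ys)\<close> lowers it by the squared norm of \<open>A *v ys\<close>. At an
  equilibrium both amounts are therefore 0.\<close>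

lemma nash_equilibrium_bilinear_game_iff:
  fixes A :: "real ^ 'n ^ 'n"
  assumes A: "invertible A"
  shows "nash_equilibrium (bilinear_game A) xs ys \<longleftrightarrow> xs = 0 \<and> ys = 0"
proof
  assume nash: "nash_equilibrium (bilinear_game A) xs ys"
  obtain A' where A': "A ** A' = mat 1" "A' ** A = mat 1" using A by (auto simp: invertible_def)
  have "xs \<bullet> (A *v (ys + A' *v xs)) \<le> xs \<bullet> (A *v ys)"
    using nash by (simp add: nash_equilibrium_def bilinear_game_def)
  then have "xs \<bullet> xs \<le> 0"
    by (simp add: matrix_vector_right_distrib matrix_vector_mul_assoc A' inner_add_right)
  then have "xs = 0" by (metis inner_eq_zero_iff inner_ge_zero order_antisym)
  moreover have "xs \<bullet> (A *v ys) \<le> (xs - A *v ys) \<bullet> (A *v ys)"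
    using nash by (simp add: nash_equilibrium_def bilinear_game_def)
  then have "(A *v ys) \<bullet> (A *v ys) \<le> 0" by (simp add: inner_diff_left)
  then have "A *v ys = 0" by (metis inner_eq_zero_iff inner_ge_zero order_antisym)
  then have "A' *v (A *v ys) = 0" by simp
  then have "ys = 0" by (simp add: matrix_vector_mul_assoc A')
  ultimately show "xs = 0 \<and> ys = 0" by simp
qed (simp add: nash_equilibrium_def bilinear_game_def)

section \<open>The dynamics as polynomial equations in the shift, and sufficiency of
  stability\<close>

lemma shift_op_hgda_S:
  "shift_op (hgda_S k p) x t = x (t + k) - (\<Sum>i=1..k. p i * x (t + k - i))"
  by (simp add: hgda_S_def shift_op_diff shift_op_sum shift_op_monom)

lemma shift_op_hgda_G:
  "shift_op (hgda_G k q) x t = (\<Sum>i=1..k. q i * x (t + k - i))"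
  by (simp add: hgda_G_def shift_op_sum shift_op_monom)

lemma hgda_dynamics_iff:
  "hgda_dynamics A \<eta> k p q x y \<longleftrightarrow> (\<forall>t i.
     shift_op (hgda_S k p) (\<lambda>t. x t $ i) t
       = - \<eta> * shift_op (hgda_G k q) (\<lambda>t. (A *v y t) $ i) t \<and>
     shift_op (hgda_S k p) (\<lambda>t. y t $ i) t
       = \<eta> * shift_op (hgda_G k q) (\<lambda>t. (transpose A *v x t) $ i) t)"
  by (auto simp: hgda_dynamics_def vec_eq_iff shift_op_hgda_S shift_op_hgda_G algebra_simps)

lemma shift_op_matrix_vector:
  "shift_op p (\<lambda>t. (N *v x t) $ i) t = (\<Sum>j\<in>UNIV. N $ i $ j * shift_op p (\<lambda>t. x t $ j) t)"
  by (simp add: matrix_vector_mult_def shift_op_seq_sum shift_op_seq_cmult)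

text \<open>The system has the polynomial matrix \<open>- S\<^sup>2 I - G\<^sup>2 M\<close>, whose
  determinant is the homogenized characteristic polynomial at \<open>s = - S\<^sup>2\<close> and
  \<open>g = G\<^sup>2\<close>.\<close>

lemma second_order_system_charpoly:
  fixes M :: "real ^ 'n ^ 'n" and x :: "nat \<Rightarrow> real ^ 'n"
  assumes chi: "charpoly M = monom 1 CARD('n) + (\<Sum>i=1..CARD('n). monom (a i) (CARD('n) - i))"
    and rec: "\<And>i t. shift_op (S\<^sup>2) (\<lambda>t. x t $ i) t = - shift_op (G\<^sup>2) (\<lambda>t. (M *v x t) $ i) t"
  shows "shift_op ((- (S\<^sup>2)) ^ CARD('n) +
      (\<Sum>i=1..CARD('n). smult (a i) ((- (S\<^sup>2)) ^ (CARD('n) - i) * (G\<^sup>2) ^ i)))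
    (\<lambda>t. x t $ l) t = 0"
proof -
  let ?B = "\<chi> i j. (if i = j then - (S\<^sup>2) else 0) - smult (M $ i $ j) (G\<^sup>2) :: real poly ^ 'n ^ 'n"
  have "(\<Sum>j\<in>UNIV. shift_op (?B $ i $ j) (\<lambda>t. x t $ j) t) = 0" for i t
  proof -
    have "(\<Sum>j\<in>UNIV. shift_op (?B $ i $ j) (\<lambda>t. x t $ j) t)
      = (\<Sum>j\<in>UNIV. (if i = j then - shift_op (S\<^sup>2) (\<lambda>t. x t $ j) t else 0)
          - M $ i $ j * shift_op (G\<^sup>2) (\<lambda>t. x t $ j) t)"
      by (rule sum.cong) (auto simp: shift_op_diff shift_op_minus shift_op_smult)
    then show ?thesis
      by (simp add: sum_subtractf rec shift_op_matrix_vector)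
  qed
  from shift_op_det_eq_0[of ?B "\<lambda>j t. x t $ j", OF this]
  show ?thesis by (simp only: det_homogeneous_charpoly_poly[OF chi])
qed

text \<open>Stated for \<open>A y\<close> rather than \<open>y\<close>, so that \<open>A A\<^sup>T\<close> governs both sequences; the equation
  for \<open>y\<close> itself involves \<open>A\<^sup>T A\<close>.\<close>

lemma hgda_second_order:
  fixes A :: "real ^ 'n ^ 'n"
  assumes dyn: "hgda_dynamics A \<eta> k p q x y"
  defines "M \<equiv> \<eta>\<^sup>2 *\<^sub>R (A ** transpose A)"
  shows "shift_op ((hgda_S k p)\<^sup>2) (\<lambda>t. x t $ i) t
      = - shift_op ((hgda_G k q)\<^sup>2) (\<lambda>t. (M *v x t) $ i) t"
    and "shift_op ((hgda_S k p)\<^sup>2) (\<lambda>t. (A *v y t) $ i) t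
      = - shift_op ((hgda_G k q)\<^sup>2) (\<lambda>t. (M *v (A *v y t)) $ i) t"
proof -
  let ?S = "shift_op (hgda_S k p)" and ?G = "shift_op (hgda_G k q)"
  let ?N = "A ** transpose A"
  \<comment> \<open>Moving S past G lets the two first-order equations be composed: S S x = - \<eta>
    G S (A y) = - \<eta>\<open>\<^sup>2\<close> G G (A A\<open>\<^sup>T\<close> x), and likewise for
    A y.\<close>
  have commute: "?S (?G u) s = ?G (?S u) s" for u s
    by (simp add: mult.commute flip: shift_op_mult)
  have M: "M *v u = \<eta>\<^sup>2 *\<^sub>R (?N *v u)" for u
    by (simp add: M_def vec_eq_iff matrix_vector_mult_def sum_distrib_left mult.assoc)
  have Sx: "?S (\<lambda>t. x t $ j) = (\<lambda>s. - \<eta> * ?G (\<lambda>t. (A *v y t) $ j) s)" for j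
    using dyn by (auto simp: hgda_dynamics_iff)
  have Sz: "?S (\<lambda>t. (A *v y t) $ j) = (\<lambda>s. \<eta> * ?G (\<lambda>t. (?N *v x t) $ j) s)" for j
  proof
    fix s
    have "?S (\<lambda>t. (A *v y t) $ j) s
      = (\<Sum>l\<in>UNIV. A $ j $ l * (\<eta> * ?G (\<lambda>t. (transpose A *v x t) $ l) s))"
      using dyn by (simp add: shift_op_matrix_vector[of _ A] hgda_dynamics_iff)
    also have "\<dots> = \<eta> * ?G (\<lambda>t. (A *v (transpose A *v x t)) $ j) s"
      by (simp only: shift_op_matrix_vector[of _ A] sum_distrib_left mult.left_commute)
    finally show "?S (\<lambda>t. (A *v y t) $ j) s = \<eta> * ?G (\<lambda>t. (?N *v x t) $ j) s"
      by (simp only: matrix_vector_mul_assoc)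
  qed
  show "shift_op ((hgda_S k p)\<^sup>2) (\<lambda>t. x t $ i) t
      = - shift_op ((hgda_G k q)\<^sup>2) (\<lambda>t. (M *v x t) $ i) t"
    unfolding M power2_eq_square shift_op_mult Sx shift_op_seq_cmult commute Sz
      vector_scaleR_component real_scaleR_def by simp
  show "shift_op ((hgda_S k p)\<^sup>2) (\<lambda>t. (A *v y t) $ i) t
      = - shift_op ((hgda_G k q)\<^sup>2) (\<lambda>t. (M *v (A *v y t)) $ i) t"
    unfolding M power2_eq_square[of "hgda_S k p"] power2_eq_square[of "hgda_G k q"] shift_op_mult
      Sz shift_op_seq_cmult commute shift_op_matrix_vector[of _ ?N] Sx
      vector_scaleR_component real_scaleR_def shift_op_seq_sum
    by (simp add: power2_eq_square sum_distrib_left mult_ac flip: sum_negf)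
qed

lemma hgda_stable_tendsto_0:
  fixes A :: "real ^ 'n ^ 'n"
  assumes A: "invertible A"
    and chi: "charpoly (\<eta>\<^sup>2 *\<^sub>R (A ** transpose A)) =
      monom 1 CARD('n) + (\<Sum>i=1..CARD('n). monom (a i) (CARD('n) - i))"
    and stable: "stable_poly ((- ((hgda_S k p)\<^sup>2)) ^ CARD('n) +
      (\<Sum>i=1..CARD('n). smult (a i)
        ((- ((hgda_S k p)\<^sup>2)) ^ (CARD('n) - i) * ((hgda_G k q)\<^sup>2) ^ i)))"
    and dyn: "hgda_dynamics A \<eta> k p q x y"
  shows "x \<longlonglongrightarrow> 0" and "y \<longlonglongrightarrow> 0"
proof -
  have lim: "u \<longlonglongrightarrow> 0"
    if "\<And>i t. shift_op ((hgda_S k p)\<^sup>2) (\<lambda>t. u t $ i) t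
      = - shift_op ((hgda_G k q)\<^sup>2) (\<lambda>t. ((\<eta>\<^sup>2 *\<^sub>R (A ** transpose A)) *v u t) $ i) t"
    for u :: "nat \<Rightarrow> real ^ 'n"
  proof (rule vec_tendstoI)
    fix i
    show "(\<lambda>t. u t $ i) \<longlonglongrightarrow> 0 $ i"
      using stable_poly_recurrence_tendsto_0[OF stable second_order_system_charpoly[OF chi that]]
      by simp
  qed
  show "x \<longlonglongrightarrow> 0" by (rule lim) (rule hgda_second_order(1)[OF dyn])
  have z: "(\<lambda>t. A *v y t) \<longlonglongrightarrow> 0" by (rule lim) (rule hgda_second_order(2)[OF dyn])
  obtain A' where A': "A' ** A = mat 1" using A by (auto simp: invertible_def)
  have "(\<lambda>t. A' *v (A *v y t)) \<longlonglongrightarrow> A' *v 0"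
    by (rule bounded_linear.tendsto[OF matrix_vector_mul_bounded_linear z])
  then show "y \<longlonglongrightarrow> 0" by (simp add: matrix_vector_mul_assoc A')
qed

section \<open>Necessity of stability: real solutions built from complex roots\<close>

lemma smult_eq_mult_vec_scale:
  fixes B :: "'a::field ^ 'n ^ 'm"
  assumes "a *s v = b *s (B *v w)"
  shows "a *s (c *s v) = b *s (B *v (c *s w))"
proof -
  have "a *s (c *s v) = c *s (a *s v)" by (simp add: vector_smult_assoc mult.commute)
  also have "\<dots> = b *s (B *v (c *s w))"
    by (simp add: assms vector_scalar_commute vector_smult_assoc mult.commute)
  finally show ?thesis .
qed

definition cmat :: "real ^ 'n ^ 'm \<Rightarrow> complex ^ 'n ^ 'm" where
  "cmat A = (\<chi> i j. complex_of_real (A $ i $ j))"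

lemma cmat_mult: "cmat (A ** B) = cmat A ** cmat B"
  by (simp add: cmat_def matrix_matrix_mult_def vec_eq_iff)

lemma cmat_mat_1: "cmat (mat 1) = mat 1"
  by (simp add: cmat_def mat_def vec_eq_iff)

text \<open>A root \<open>z\<close> of the polynomial makes the symbol of the first-order system singular. If
  \<open>S(z) \<noteq> 0\<close>, the second equation can be solved for \<open>w\<close>; otherwise \<open>w = 0\<close> works.\<close>

lemma hgda_symbol_null_vector:
  fixes A :: "real ^ 'n ^ 'n" and S G :: complex
  assumes A: "invertible A"
    and det: "det (\<chi> i j. (if i = j then - S\<^sup>2 else 0)
      - G\<^sup>2 * of_real ((\<eta>\<^sup>2 *\<^sub>R (A ** transpose A)) $ i $ j) :: complex ^ 'n ^ 'n) = 0"
  obtains v w where "v \<noteq> 0" "S *s v = - (of_real \<eta> * G) *s (cmat A *v w)"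
    "S *s w = (of_real \<eta> * G) *s (cmat (transpose A) *v v)"
proof -
  let ?h = "of_real \<eta> * G"
  from singular_matrix_null_vector[OF det] obtain v where v0: "v \<noteq> 0" and
    v: "(\<chi> i j. (if i = j then - S\<^sup>2 else 0)
      - G\<^sup>2 * of_real ((\<eta>\<^sup>2 *\<^sub>R (A ** transpose A)) $ i $ j) :: complex ^ 'n ^ 'n) *v v = 0"
    by blast
  have "(\<chi> i j. (if i = j then - S\<^sup>2 else 0)
      - G\<^sup>2 * of_real ((\<eta>\<^sup>2 *\<^sub>R (A ** transpose A)) $ i $ j) :: complex ^ 'n ^ 'n) *v v
    = - (S\<^sup>2 *s v) - ?h\<^sup>2 *s (cmat (A ** transpose A) *v v)"
    (is "?B *v v = _")
  proof (subst vec_eq_iff, rule allI)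
    fix i
    have "(?B *v v) $ i = (\<Sum>j\<in>UNIV. (if i = j then - S\<^sup>2 * v $ j else 0)
        - ?h\<^sup>2 * (cmat (A ** transpose A) $ i $ j * v $ j))"
      unfolding matrix_vector_mult_def vec_lambda_beta
      by (rule sum.cong) (auto simp: cmat_def algebra_simps power_mult_distrib)
    then show "(?B *v v) $ i = (- (S\<^sup>2 *s v) - ?h\<^sup>2 *s (cmat (A ** transpose A) *v v)) $ i"
      by (simp add: sum_subtractf matrix_vector_mult_def sum_distrib_left)
  qed
  with v have eq: "S\<^sup>2 *s v = - (?h\<^sup>2 *s (cmat A *v (cmat (transpose A) *v v)))"
    by (simp add: cmat_mult matrix_vector_mul_assoc eq_neg_iff_add_eq_0 neg_eq_iff_add_eq_0
        diff_eq_eq)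
  show thesis
  proof (cases "S = 0")
    case False
    define w where "w = (?h / S) *s (cmat (transpose A) *v v)"
    \<comment> \<open>After multiplication by \<open>S\<close>, the first equation is
      \<open>eq\<close> with \<open>w\<close> inserted; \<open>S\<close> is then cancelled.\<close>
    have "S *s (S *s v) = S *s (- ?h *s (cmat A *v w))"
      using eq False
      by (simp add: w_def vec_eq_iff power2_eq_square vector_scalar_commute)
    then have "S *s v = - ?h *s (cmat A *v w)"
      using False by (metis vector_mul_lcancel)
    moreover have "S *s w = ?h *s (cmat (transpose A) *v v)"
      using False by (simp add: w_def)
    ultimately show thesis using v0 that by blast
  next
    case True
    \<comment> \<open>With \<open>S = 0\<close>, \<open>eq\<close> says that
      \<open>?h\<^sup>2\<close> times \<open>A A\<^sup>T v\<close> is 0. Either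
      \<open>?h = 0\<close>, or \<open>?h\<^sup>2\<close> and then \<open>A\<close> can be
      cancelled.\<close>
    have "?h *s (cmat (transpose A) *v v) = 0"
    proof (cases "?h = 0")
      case False
      obtain A' where "A' ** A = mat 1" using A by (auto simp: invertible_def)
      then have A': "cmat A' ** cmat A = mat 1" by (simp add: cmat_mat_1 flip: cmat_mult)
      have "cmat A *v (cmat (transpose A) *v v) = 0" using eq True False by simp
      then have "cmat A' *v (cmat A *v (cmat (transpose A) *v v)) = 0" by simp
      then show ?thesis by (simp add: matrix_vector_mul_assoc[of "cmat A'"] A')
    qed simp
    then show thesis using v0 True that[of v 0] by simp
  qed
qed

text \<open>On geometric sequences the operators act as multiplication by their values at
  \<open>z\<close>, so the dynamics reduce to the two hypotheses. Real parts remain solutions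
  because all coefficients of the dynamics are real.\<close>

lemma hgda_dynamics_Re_geometric:
  fixes A :: "real ^ 'n ^ 'n" and z :: complex
  assumes v: "real_poly_eval (hgda_S k p) z *s v
      = - (of_real \<eta> * real_poly_eval (hgda_G k q) z) *s (cmat A *v w)"
    and w: "real_poly_eval (hgda_S k p) z *s w
      = (of_real \<eta> * real_poly_eval (hgda_G k q) z) *s (cmat (transpose A) *v v)"
  shows "hgda_dynamics A \<eta> k p q (\<lambda>t. \<chi> i. Re (z ^ t * v $ i)) (\<lambda>t. \<chi> i. Re (z ^ t * w $ i))"
proof -
  have geo: "shift_op r (\<lambda>t. Re (z ^ t * c)) t = Re (z ^ t * (real_poly_eval r z * c))" for r c t
    unfolding shift_op_Re shift_op_geometric real_poly_eval_def by (simp only: mult_ac)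
  have mv: "(B *v (\<chi> i. Re (z ^ t * u $ i))) $ i = Re (z ^ t * (cmat B *v u) $ i)"
    for B :: "real ^ 'n ^ 'n" and u t i
    by (simp add: matrix_vector_mult_def cmat_def sum_distrib_left Re_sum algebra_simps)
  have Re_of_real_mult: "Re (of_real c * u) = c * Re u" for c u by simp
  have "z ^ t * (real_poly_eval (hgda_S k p) z * v $ i)
      = of_real (- \<eta>) * (z ^ t * (real_poly_eval (hgda_G k q) z * (cmat A *v w) $ i))"
    "z ^ t * (real_poly_eval (hgda_S k p) z * w $ i)
      = of_real \<eta> * (z ^ t * (real_poly_eval (hgda_G k q) z * (cmat (transpose A) *v v) $ i))" for t i
    using arg_cong[OF v, of "\<lambda>u. u $ i"] arg_cong[OF w, of "\<lambda>u. u $ i"]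
    by (simp_all add: mult_ac)
  then show ?thesis
    unfolding hgda_dynamics_iff mv by (simp only: vec_lambda_beta geo Re_of_real_mult simp_thms)
qed

theorem theorem4p1:
  fixes A :: "real ^ 'n ^ 'n" and \<eta> :: real and k :: nat
    and p q a :: "nat \<Rightarrow> real"
  assumes "invertible A"
    and "k \<ge> 1"
    and "poly (hgda_S k p) 1 = 0"
    and "poly (hgda_G k q) 1 \<noteq> 0"
    and "charpoly (\<eta>\<^sup>2 *\<^sub>R (A ** transpose A)) =
           monom 1 CARD('n) + (\<Sum>i=1..CARD('n). monom (a i) (CARD('n) - i))"
  shows "(\<forall>x y. hgda_dynamics A \<eta> k p q x y \<longrightarrow>
            (\<exists>xs ys. nash_equilibrium (bilinear_game A) xs ys \<and>
               x \<longlonglongrightarrow> xs \<and> y \<longlonglongrightarrow> ys))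
         \<longleftrightarrow>
         stable_poly ((- ((hgda_S k p)\<^sup>2)) ^ CARD('n) +
           (\<Sum>i=1..CARD('n). smult (a i)
              ((- ((hgda_S k p)\<^sup>2)) ^ (CARD('n) - i) * ((hgda_G k q)\<^sup>2) ^ i)))"
proof -
  let ?P = "(- ((hgda_S k p)\<^sup>2)) ^ CARD('n) + (\<Sum>i=1..CARD('n). smult (a i)
      ((- ((hgda_S k p)\<^sup>2)) ^ (CARD('n) - i) * ((hgda_G k q)\<^sup>2) ^ i))"
  show ?thesis
  proof
    assume conv: "\<forall>x y. hgda_dynamics A \<eta> k p q x y \<longrightarrow>
      (\<exists>xs ys. nash_equilibrium (bilinear_game A) xs ys \<and> x \<longlonglongrightarrow> xs \<and> y \<longlonglongrightarrow> ys)"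
    have x_lim: "x \<longlonglongrightarrow> 0" if "hgda_dynamics A \<eta> k p q x y" for x y
      using conv that by (auto simp: nash_equilibrium_bilinear_game_iff[OF assms(1)])
    show "stable_poly ?P"
      unfolding stable_poly_def
    proof (intro allI impI)
      fix z :: complex
      assume "poly (map_poly complex_of_real ?P) z = 0"
      then have "real_poly_eval ?P z = 0" by (simp add: real_poly_eval_def)
      then have "det (\<chi> i j. (if i = j then - (real_poly_eval (hgda_S k p) z)\<^sup>2 else 0)
        - (real_poly_eval (hgda_G k q) z)\<^sup>2
          * of_real ((\<eta>\<^sup>2 *\<^sub>R (A ** transpose A)) $ i $ j) :: complex ^ 'n ^ 'n) = 0"
        \<comment> \<open>The value of \<open>?P\<close> at \<open>z\<close> is this determinant, by
          homogenization with \<open>s\<close> the negated square of S(z) and \<open>g\<close> the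
          square of G(z).\<close>
        by (subst det_homogeneous_charpoly[OF assms(5)]) simp
      from hgda_symbol_null_vector[OF assms(1) this] obtain v w where v0: "v \<noteq> 0"
        and v: "real_poly_eval (hgda_S k p) z *s v
          = - (of_real \<eta> * real_poly_eval (hgda_G k q) z) *s (cmat A *v w)"
        and w: "real_poly_eval (hgda_S k p) z *s w
          = (of_real \<eta> * real_poly_eval (hgda_G k q) z) *s (cmat (transpose A) *v v)"
        by blast
      obtain i where i: "v $ i \<noteq> 0" using v0 by (auto simp: vec_eq_iff)
      \<comment> \<open>The factor \<open>c\<close> rotates the complex solution:
        \<open>c = 1\<close> gives the real part of \<open>z ^ t * v $ i\<close>, and
        \<open>c = - \<i>\<close> its imaginary part.\<close>
      have Re_lim: "(\<lambda>t. Re (z ^ t * (c * v $ i))) \<longlonglongrightarrow> 0" for c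
      proof -
        have "(\<lambda>t. \<chi> i. Re (z ^ t * (c *s v) $ i)) \<longlonglongrightarrow> 0"
          by (rule x_lim, rule hgda_dynamics_Re_geometric[OF smult_eq_mult_vec_scale[OF v]
                smult_eq_mult_vec_scale[OF w]])
        from tendsto_vec_nth[OF this, of i] show ?thesis by simp
      qed
      have "(\<lambda>t. Im (z ^ t * v $ i)) \<longlonglongrightarrow> 0" using Re_lim[of "- \<i>"] by (simp add: add.commute)
      moreover have "(\<lambda>t. Re (z ^ t * v $ i)) \<longlonglongrightarrow> 0" using Re_lim[of 1] by simp
      ultimately have "(\<lambda>t. z ^ t * v $ i) \<longlonglongrightarrow> 0" by (simp add: tendsto_complex_iff)
      \<comment> \<open>The threshold \<open>norm (v $ i)\<close> makes some power of
        \<open>norm z\<close> less than 1, which is impossible if \<open>norm z\<close> is at least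
        1.\<close>
      from LIMSEQ_D[OF this, of "norm (v $ i)"] i obtain t
        where "norm (z ^ t * v $ i) < norm (v $ i)" by auto
      then have "norm z ^ t < 1" using i by (simp add: norm_mult norm_power)
      then show "norm z < 1" using one_le_power[of "norm z" t] by fastforce
    qed
  next
    assume stable: "stable_poly ?P"
    show "\<forall>x y. hgda_dynamics A \<eta> k p q x y \<longrightarrow>
      (\<exists>xs ys. nash_equilibrium (bilinear_game A) xs ys \<and> x \<longlonglongrightarrow> xs \<and> y \<longlonglongrightarrow> ys)"
      using hgda_stable_tendsto_0[OF assms(1,5) stable]
      by (simp add: nash_equilibrium_bilinear_game_iff[OF assms(1)])
  qed
qed

end
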